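(* Let $q \in (1,2)$ be a regular Pisot number and $q'$ a Galois conjugate of $q$. Then $|q'| \geq \frac{\sqrt5-1}{2}$.
   Context: A Pisot number is a real algebraic integer $q>1$ all of whose other Galois conjugates have absolute value strictly less than $1$. For integers $r \geq 1$ let $\Phi_r(x) = x^{r+1}-2x^r+x-1$, $\Psi_r(x) = x^{r+1}-x^r-\cdots-x-1$, and let $X(x) = x^4-x^3-2x^2+1$. Let $\phi_r$, $\psi_r$, $\chi$ be the roots in $(1,2)$ of $\Phi_r$, $\Psi_r$, $X$ respectively (these are the limit points of the Pisot numbers in $(1,2)$). For integers $r \geq 1$, $n \geq 1$ define $\Phi_{A,r,n}^{\pm}(x) = \Phi_r(x)x^n \pm (x^r-x^{r-1}+1)$, $\Phi_{B,r,n}^{\pm}(x) = \Phi_r(x)x^n \pm (x^r-x+1)$, $\Phi_{C,r,n}^{\pm}(x) = \Phi_r(x)x^n \pm (x^r+1)(x-1)$, $\Psi_{A,r,n}^{\pm}(x) = \Psi_r(x)x^n \pm (x^{r+1}-1)$, $\Psi_{B,r,n}^{\pm}(x) = \Psi_r(x)x^n \pm (x^r-1)/(x-1)$, $X_{A,n}^{\pm}(x) = X(x)x^n \pm (x^3+x^2-x-1)$, $X_{B,n}^{\pm}(x) = X(x)x^n \pm (x^4-x^2+1)$. A regular Pisot number in $(1,2)$ is either one of the numbers $\phi_r, \psi_r$ ($r\ge1$), $\chi$, or a Pisot number in $(1,2)$ which is a root of one of the polynomials $\Phi_{A,r,n}^{\pm},\Phi_{B,r,n}^{\pm},\Phi_{C,r,n}^{\pm},\Psi_{A,r,n}^{\pm},\Psi_{B,r,n}^{\pm},X_{A,n}^{\pm},X_{B,n}^{\pm}$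 (for some $r \ge 1$, $n\ge 1$). *)

theory Defs
  imports Complex_Main "HOL-Computational_Algebra.Polynomial"
    "HOL-Computational_Algebra.Polynomial_Factorial"
begin

definition algebraic_integer :: "real \<Rightarrow> bool" where
  "algebraic_integer x \<longleftrightarrow>
     (\<exists>p :: int poly. lead_coeff p = 1 \<and> poly (map_poly of_int p) x = 0)"

definition galois_conjugate :: "real \<Rightarrow> complex \<Rightarrow> bool" where
  "galois_conjugate q z \<longleftrightarrow>
     (\<exists>p :: int poly. irreducible p \<and> poly (map_poly of_int p) q = 0
                      \<and> poly (map_poly of_int p) z = 0)"

definition pisot :: "real \<Rightarrow> bool" where
  "pisot q \<longleftrightarrow> q > 1 \<and> algebraic_integer q \<and>
     (\<forall>z. galois_conjugate q z \<and> z \<noteq> complex_of_real q \<longrightarrow> cmod z < 1)"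

definition Phi :: "nat \<Rightarrow> real \<Rightarrow> real" where
  "Phi r x = x^(r+1) - 2 * x^r + x - 1"

definition Psi :: "nat \<Rightarrow> real \<Rightarrow> real" where
  "Psi r x = x^(r+1) - (\<Sum>i\<le>r. x^i)"

definition Chi :: "real \<Rightarrow> real" where
  "Chi x = x^4 - x^3 - 2 * x^2 + 1"

text \<open>The families of polynomials; the sign argument s is +1 or -1.
  Note (x^r - 1)/(x - 1) = sum of x^i for i < r.\<close>
definition PhiA :: "nat \<Rightarrow> nat \<Rightarrow> real \<Rightarrow> real \<Rightarrow> real" where
  "PhiA r n s x = Phi r x * x^n + s * (x^r - x^(r-1) + 1)"
definition PhiB :: "nat \<Rightarrow> nat \<Rightarrow> real \<Rightarrow> real \<Rightarrow> real" where
  "PhiB r n s x = Phi r x * x^n + s * (x^r - x + 1)"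
definition PhiC :: "nat \<Rightarrow> nat \<Rightarrow> real \<Rightarrow> real \<Rightarrow> real" where
  "PhiC r n s x = Phi r x * x^n + s * ((x^r + 1) * (x - 1))"
definition PsiA :: "nat \<Rightarrow> nat \<Rightarrow> real \<Rightarrow> real \<Rightarrow> real" where
  "PsiA r n s x = Psi r x * x^n + s * (x^(r+1) - 1)"
definition PsiB :: "nat \<Rightarrow> nat \<Rightarrow> real \<Rightarrow> real \<Rightarrow> real" where
  "PsiB r n s x = Psi r x * x^n + s * (\<Sum>i<r. x^i)"
definition ChiA :: "nat \<Rightarrow> real \<Rightarrow> real \<Rightarrow> real" where
  "ChiA n s x = Chi x * x^n + s * (x^3 + x^2 - x - 1)"
definition ChiB :: "nat \<Rightarrow> real \<Rightarrow> real \<Rightarrow> real" where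
  "ChiB n s x = Chi x * x^n + s * (x^4 - x^2 + 1)"

text \<open>phi_r, psi_r, chi are the (unique) roots in (1,2) of Phi_r, Psi_r, X.\<close>
definition limit_pisot :: "real \<Rightarrow> bool" where
  "limit_pisot q \<longleftrightarrow> 1 < q \<and> q < 2 \<and>
     ((\<exists>r\<ge>1. Phi r q = 0) \<or> (\<exists>r\<ge>1. Psi r q = 0) \<or> Chi q = 0)"

definition regular_pisot :: "real \<Rightarrow> bool" where
  "regular_pisot q \<longleftrightarrow> limit_pisot q \<or>
     (pisot q \<and> 1 < q \<and> q < 2 \<and>
      (\<exists>r\<ge>1. \<exists>n\<ge>1. \<exists>s\<in>{1, -1::real}.
         PhiA r n s q = 0 \<or> PhiB r n s q = 0 \<or> PhiC r n s q = 0 \<or>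
         PsiA r n s q = 0 \<or> PsiB r n s q = 0 \<or> ChiA n s q = 0 \<or> ChiB n s q = 0))"

end

theory Submission
  imports Defs
begin

text \<open>
  A conjugate of \<open>q\<close> is a root of every integer polynomial that vanishes at \<open>q\<close>. After multiplying the
  two \<open>Psi\<close> families by \<open>x - 1\<close>, each defining polynomial has the shape
  \<open>F = A + B x\<^sup>r + C x\<^sup>n + D x\<^sup>r x\<^sup>n\<close> with fixed integer polynomials \<open>A, B, C, D\<close> and \<open>A(0) = \<plusminus>1\<close>.
  Multiplying by a truncation \<open>G\<close> of the power series \<open>1/A\<close> turns \<open>F\<close> into \<open>1\<close> plus terms whose
  coefficient sums, weighted by powers of \<open>5/8\<close>, add up to less than \<open>1\<close>, as soon as \<open>r\<close> and \<open>n\<close> are not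
  too small; hence \<open>F\<close> has no root of modulus at most \<open>5/8\<close>, and \<open>5/8\<close> exceeds the reciprocal of the golden ratio.
  Small exponents are absorbed into \<open>A, B, C, D\<close> and treated in the same way, up to a possible factor
  \<open>x\<^sup>2 - x - 1\<close>, whose roots have modulus at least the claimed bound. The polynomials that do have smaller roots
  (for instance \<open>PhiA\<close> with \<open>n = 1\<close> and negative sign) have no root in \<open>(1,2)\<close> at all.
\<close>

section \<open>Arithmetic of coefficient lists\<close>

text \<open>Polynomials are lists of integer coefficients, constant term first, so that the estimates can be
  decided by evaluation.\<close>

abbreviation evl :: "int list \<Rightarrow> 'a::comm_ring_1 \<Rightarrow> 'a" where
  "evl cs x \<equiv> horner_sum of_int x cs"

fun ladd :: "int list \<Rightarrow> int list \<Rightarrow> int list" where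
  "ladd [] b = b"
| "ladd (x # a) b = (case b of [] \<Rightarrow> x # a | y # b' \<Rightarrow> (x + y) # ladd a b')"

definition lscale :: "int \<Rightarrow> int list \<Rightarrow> int list" where
  "lscale c a = map (\<lambda>x. c * x) a"

fun lmul :: "int list \<Rightarrow> int list \<Rightarrow> int list" where
  "lmul [] b = []"
| "lmul (x # a) b = ladd (lscale x b) (0 # lmul a b)"

lemma evl_ladd: "evl (ladd a b) x = evl a x + evl b x"
  by (induction a b rule: ladd.induct) (auto simp: algebra_simps split: list.split)

lemma evl_lscale: "evl (lscale c a) x = of_int c * evl a x"
  by (induction a) (auto simp: lscale_def algebra_simps)

lemma evl_lmul: "evl (lmul a b) x = evl a x * evl b x"
  by (induction a b rule: lmul.induct) (auto simp: evl_ladd evl_lscale algebra_simps)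

text \<open>Division by increasing powers, with remainder of order \<open>k\<close>; it is exact only if the constant term
  of the divisor is its own inverse.\<close>

fun series_div :: "nat \<Rightarrow> int list \<Rightarrow> int list \<Rightarrow> int list \<times> int list" where
  "series_div 0 a d = ([], a)"
| "series_div (Suc k) a d =
     (if a = [] then ([], [])
      else let h = hd a * hd d;
               (g, e) = series_div k (ladd (tl a) (lscale (- h) (tl d))) d
           in (h # g, e))"

lemma evl_series_div:
  assumes "series_div k a d = (g, e)" and "\<bar>hd d\<bar> = 1" and "d \<noteq> []"
  shows "evl a x = evl d x * evl g x + x ^ k * evl e x"
  using assms(1)
proof (induction k arbitrary: a g e)
  case (Suc k)
  obtain y d' where d: "d = y # d'" using assms(3) by (cases d) auto
  have y: "y = 1 \<or> y = -1" using assms(2) d by auto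
  show ?case
  proof (cases a)
    case Nil
    then show ?thesis using Suc.prems by auto
  next
    case (Cons u a')
    obtain g' e' where ge: "series_div k (ladd a' (lscale (- (u * y)) d')) d = (g', e')" by force
    have IH: "evl a' x = of_int (u * y) * evl d' x + evl d x * evl g' x + x ^ k * evl e' x"
      using Suc.IH[OF ge] by (simp add: evl_ladd evl_lscale algebra_simps)
    have "g = (u * y) # g'" "e = e'"
      using Suc.prems ge by (auto simp: Cons d)
    \<comment> \<open>Since \<open>y\<close> is 1 or -1, \<open>u * y * y = u\<close>, so
      subtracting \<open>h\<close> times \<open>d\<close> cancels the constant term of
      \<open>a\<close>.\<close>
    with y show ?thesis
      by (auto simp: Cons d IH algebra_simps)
  qed
qed simp

section \<open>Estimates on the disc of radius 5/8\<close>

text \<open>\<open>1000\<close> times the sum of \<open>\<bar>c\<^sub>i\<bar> (5/8)\<^sup>i\<close>, rounded up at every Horner step to stay within the integers.\<close>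

fun weight :: "int list \<Rightarrow> int" where
  "weight [] = 0"
| "weight (c # cs) = 1000 * \<bar>c\<bar> + (5 * weight cs + 7) div 8"

lemma norm_evl_le_weight:
  assumes "cmod z \<le> 5 / 8"
  shows "1000 * cmod (evl cs z) \<le> of_int (weight cs)"
proof (induction cs)
  case (Cons c cs)
  have "1000 * cmod (evl (c # cs) z) \<le> 1000 * (\<bar>of_int c\<bar> + cmod z * cmod (evl cs z))"
    using norm_triangle_ineq[of "of_int c" "z * evl cs z"] by (simp add: norm_mult)
  also have "\<dots> \<le> 1000 * \<bar>of_int c\<bar> + 5 / 8 * of_int (weight cs)"
    using mult_mono[OF assms Cons] by simp
  also have "\<dots> \<le> of_int (weight (c # cs))"
  proof -
    \<comment> \<open>Adding 7 before dividing by 8 rounds up.\<close>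
    have "5 * weight cs \<le> 8 * ((5 * weight cs + 7) div 8)" by presburger
    hence "5 * real_of_int (weight cs) \<le> 8 * of_int ((5 * weight cs + 7) div 8)"
      by (metis (mono_tags) of_int_le_iff of_int_mult of_int_numeral)
    thus ?thesis by simp
  qed
  finally show ?case .
qed simp

text \<open>The exponents stay symbolic while the coefficients are concrete, so one evaluation
  settles all \<open>r\<close> and \<open>n\<close> at once.\<close>

definition form :: "int list \<Rightarrow> int list \<Rightarrow> int list \<Rightarrow> int list \<Rightarrow> nat \<Rightarrow> nat \<Rightarrow> 'a::comm_ring_1 \<Rightarrow> 'a" where
  "form A B C D r n x = evl A x + evl B x * x ^ r + evl C x * x ^ n + evl D x * x ^ (r + n)"

text \<open>Here \<open>1 = A * G + x^k * E\<close>. The zeros before \<open>E\<close> account for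
  \<open>(5/8)^k\<close>, and 1000 stands for 1 because \<open>weight\<close> is scaled.\<close>

definition dominated :: "nat \<Rightarrow> int list \<Rightarrow> int list \<Rightarrow> int list \<Rightarrow> int list \<Rightarrow> bool" where
  "dominated k A B C D \<longleftrightarrow>
     (if A = [] then False else if \<bar>hd A\<bar> \<noteq> 1 then False else
      (case series_div k [1] A of (G, E) \<Rightarrow>
        weight (replicate k 0 @ E) + weight (lmul B G) + weight (lmul C G) + weight (lmul D G) < 1000))"

lemma evl_shift: "evl (replicate k 0 @ E) x = x ^ k * evl E x"
  by (induction k) (auto simp: algebra_simps)

text \<open>At a root, multiplying by \<open>G\<close> expresses 1 as a combination of terms whose
  moduli add up to less than 1.\<close>

lemma dominated_imp_nonzero:
  assumes "dominated k A B C D" and z: "cmod z \<le> 5 / 8"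
  shows "form A B C D r n z \<noteq> 0"
proof
  assume root: "form A B C D r n z = 0"
  obtain G E where GE: "series_div k [1] A = (G, E)" by force
  from assms(1) have "A \<noteq> []" "\<bar>hd A\<bar> = 1"
    and w: "weight (replicate k 0 @ E) + weight (lmul B G) + weight (lmul C G) + weight (lmul D G) < 1000"
    by (auto simp: dominated_def GE split: if_splits)
  with evl_series_div[OF GE, of z] have inv: "1 = evl A z * evl G z + evl (replicate k 0 @ E) z"
    by (simp add: evl_shift)
  \<comment> \<open>The power \<open>z ^ m\<close> has modulus at most 1 and is discarded, which
    makes the bound uniform in \<open>r\<close> and \<open>n\<close>.\<close>
  have le: "1000 * cmod (evl cs z * z ^ m) \<le> of_int (weight cs)" for cs m
  proof -
    have "cmod z ^ m \<le> 1" using z by (intro power_le_one) auto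
    hence "cmod (evl cs z * z ^ m) \<le> cmod (evl cs z)"
      by (simp add: norm_mult norm_power mult_left_le)
    thus ?thesis using norm_evl_le_weight[OF z, of cs] by linarith
  qed
  have solve: "1 = e - b - c - d" if "0 = a + b + c + d" "1 = a + e" for a b c d e :: complex
    using that by algebra
  have "0 = evl G z * form A B C D r n z" by (simp add: root)
  also have "\<dots> = evl A z * evl G z + evl (lmul B G) z * z ^ r + evl (lmul C G) z * z ^ n
      + evl (lmul D G) z * z ^ (r + n)"
    by (simp add: form_def evl_lmul algebra_simps)
  finally have "1 = evl (replicate k 0 @ E) z * z ^ 0 - evl (lmul B G) z * z ^ r
      - evl (lmul C G) z * z ^ n - evl (lmul D G) z * z ^ (r + n)" (is "1 = ?e - ?b - ?c - ?d")
    using solve[OF _ inv] by simp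
  hence "1 = cmod (?e - ?b - ?c - ?d)" by simp
  also have "\<dots> \<le> cmod ?e + cmod ?b + cmod ?c + cmod ?d"
    by (intro order.trans[OF norm_triangle_ineq4] add_mono order.refl)
  finally have "1000 \<le> 1000 * cmod ?e + 1000 * cmod ?b + 1000 * cmod ?c + 1000 * cmod ?d" by linarith
  also have "\<dots> \<le> of_int (weight (replicate k 0 @ E) + weight (lmul B G) + weight (lmul C G) + weight (lmul D G))"
    using le[of "replicate k 0 @ E" 0] le[of "lmul B G" r] le[of "lmul C G" n] le[of "lmul D G" "r + n"]
    unfolding of_int_add by linarith
  finally show False using w by linarith
qed

section \<open>The golden factor and the case split on small exponents\<close>

text \<open>The divisor is \<open>x^2 - x - 1\<close>. Its root of modulus
  \<open>(sqrt 5 - 1) / 2\<close> lies inside the disc, so this factor has to be split off before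
  the size estimate can apply.\<close>

definition golden_multiple :: "nat \<Rightarrow> int list \<Rightarrow> bool" where
  "golden_multiple k A \<longleftrightarrow>
     (case series_div (length A) A [-1, -1, 1] of (H, E) \<Rightarrow>
       if list_all (\<lambda>c. c = 0) E then dominated k H [] [] [] else False)"

text \<open>The two recursive calls on \<open>B\<close>, \<open>D\<close> are the cases \<open>r = 0\<close> and \<open>r > 0\<close> (with \<open>r\<close> lowered by one),
  and likewise for \<open>C\<close> and \<open>n\<close>; the first argument bounds the recursion depth.
  Nested conditionals instead of connectives keep the evaluation lazy.\<close>

fun check :: "nat \<Rightarrow> nat \<Rightarrow> int list \<Rightarrow> int list \<Rightarrow> int list \<Rightarrow> int list \<Rightarrow> bool" where
  "check 0 k A B C D = False"
| "check (Suc m) k A B C D =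
    (if dominated k A B C D then True
     else if B \<noteq> [] \<or> D \<noteq> [] then
       if check m k (ladd A B) [] (ladd C D) [] then check m k A (0 # B) C (0 # D) else False
     else if C \<noteq> [] then
       if check m k (ladd A C) [] [] [] then check m k A [] (0 # C) [] else False
     else golden_multiple k A)"

lemma golden_multiple_root:
  assumes "golden_multiple k A" and "cmod z \<le> 5 / 8" and root: "evl A z = 0"
  shows "z ^ 2 = z + 1"
proof -
  obtain H E where HE: "series_div (length A) A [-1, -1, 1] = (H, E)" by force
  have E: "list_all (\<lambda>c. c = 0) E" and H: "dominated k H [] [] []"
    using assms(1) by (auto simp: golden_multiple_def HE split: if_splits)
  have "evl E z = 0" using E by (induction E) auto
  hence "evl A z = (z ^ 2 - z - 1) * evl H z"
    using evl_series_div[OF HE, of z] by (simp add: algebra_simps power2_eq_square)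
  moreover have "evl H z \<noteq> 0"
    using dominated_imp_nonzero[OF H assms(2), of 0 0] by (simp add: form_def)
  ultimately have "z ^ 2 - z - 1 = 0" using root by simp
  thus ?thesis by (simp add: algebra_simps)
qed

text \<open>The exponents of the vanishing form select a path through the calls of
  \<open>check\<close>. A leaf accepted by \<open>dominated\<close> contradicts the root, which
  leaves the multiples of \<open>x^2 - x - 1\<close>.\<close>

lemma check_root:
  assumes "check m k A B C D" and "cmod z \<le> 5 / 8" and "form A B C D r n z = 0"
  shows "z ^ 2 = z + 1"
  using assms(1,3)
proof (induction m arbitrary: A B C D r n)
  case (Suc m)
  show ?case
  proof (cases "dominated k A B C D")
    case True
    then show ?thesis using dominated_imp_nonzero assms(2) Suc.prems(2) by blast
  next
    case nd: False
    consider (r) "B \<noteq> [] \<or> D \<noteq> []" | (n) "B = []" "D = []" "C \<noteq> []" | (none) "B = []" "D = []" "C = []"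
      by blast
    then show ?thesis
    proof cases
      case r
      hence c: "check m k (ladd A B) [] (ladd C D) []" "check m k A (0 # B) C (0 # D)"
        using Suc.prems(1) nd by (auto split: if_splits)
      show ?thesis
      proof (cases r)
        case 0
        \<comment> \<open>Once \<open>B\<close> and \<open>D\<close> are empty, the exponent
          \<open>r\<close> is irrelevant and 0 is a placeholder.\<close>
        hence "form (ladd A B) [] (ladd C D) [] 0 n z = 0"
          using Suc.prems(2) by (simp add: form_def evl_ladd algebra_simps)
        then show ?thesis by (rule Suc.IH[OF c(1)])
      next
        case (Suc r')
        hence "form A (0 # B) C (0 # D) r' n z = 0"
          using Suc.prems(2) by (simp add: form_def algebra_simps)
        then show ?thesis by (rule Suc.IH[OF c(2)])
      qed
    next
      case n
      hence c: "check m k (ladd A C) [] [] []" "check m k A [] (0 # C) []"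
        using Suc.prems(1) nd by (auto split: if_splits)
      show ?thesis
      proof (cases n)
        case 0
        hence "form (ladd A C) [] [] [] 0 0 z = 0"
          using Suc.prems(2) n by (simp add: form_def evl_ladd algebra_simps)
        then show ?thesis by (rule Suc.IH[OF c(1)])
      next
        case (Suc n')
        hence "form A [] (0 # C) [] 0 n' z = 0"
          using Suc.prems(2) n by (simp add: form_def algebra_simps)
        then show ?thesis by (rule Suc.IH[OF c(2)])
      qed
    next
      case none
      then show ?thesis
        using Suc.prems nd golden_multiple_root[OF _ assms(2)] by (auto simp: form_def)
    qed
  qed
qed simp

section \<open>Conjugates as roots of integer polynomials\<close>

abbreviation ipoly :: "int poly \<Rightarrow> 'a::comm_ring_1 \<Rightarrow> 'a" where
  "ipoly p x \<equiv> poly (map_poly of_int p) x"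

lemma ipoly_add: "ipoly (p + q) x = ipoly p x + ipoly q x"
proof -
  have "map_poly of_int (p + q) = (map_poly of_int p + map_poly of_int q :: 'a poly)"
    by (intro poly_eqI) (simp add: coeff_map_poly)
  thus ?thesis by simp
qed

lemma ipoly_mult: "ipoly (p * q) x = ipoly p x * ipoly q x"
proof -
  have "map_poly of_int (p * q) = (map_poly of_int p * map_poly of_int q :: 'a poly)"
    by (intro poly_eqI) (simp add: coeff_map_poly coeff_mult)
  thus ?thesis by simp
qed

lemma ipoly_monom: "ipoly (monom 1 n) x = x ^ n"
  by (simp add: map_poly_monom poly_monom)

lemma ipoly_Poly: "ipoly (Poly cs) x = evl cs x"
  by (induction cs) (auto simp: map_poly_pCons)

lemma ipoly_const: "ipoly [:c:] x = of_int c"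
  by (simp add: map_poly_pCons)

text \<open>It suffices that the irreducible \<open>p\<close> divides \<open>P\<close>. It divides
  an annihilator \<open>m\<close> of \<open>q\<close> of minimal degree, which divides a nonzero
  constant multiple of \<open>P\<close>; primality of \<open>p\<close> then removes the
  constant.\<close>

lemma root_of_galois_conjugate:
  assumes "galois_conjugate q z" and "ipoly P q = 0"
  shows "ipoly P z = 0"
proof -
  obtain p :: "int poly" where p: "irreducible p" "ipoly p q = 0" "ipoly p z = 0"
    using assms(1) by (auto simp: galois_conjugate_def)
  have prime: "prime_elem p" using p(1) by (rule irreducible_imp_prime_elem)
  have nonconst: "c = 0" if "p dvd [:c:]" for c
  proof -
    obtain h where "[:c:] = p * h" using \<open>p dvd [:c:]\<close> by (auto elim: dvdE)
    hence "ipoly [:c:] q = 0" using p(2) by (simp add: ipoly_mult)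
    thus ?thesis by (simp add: ipoly_const)
  qed
  \<comment> \<open>Pseudo-division by an annihilator \<open>m\<close> of minimal degree replaces the passage to rational coefficients.\<close>
  define Z where "Z = (\<lambda>f :: int poly. f \<noteq> 0 \<and> ipoly f q = 0)"
  define m where "m = arg_min degree Z"
  have "Z p" using p by (auto simp: Z_def)
  hence m: "Z m" and least: "\<And>f. Z f \<Longrightarrow> degree m \<le> degree f"
    unfolding m_def by (auto intro: arg_min_natI arg_min_nat_le)
  have divides: "\<exists>c. c \<noteq> 0 \<and> m dvd smult c f" if "ipoly f q = 0" for f
  proof -
    have m0: "m \<noteq> 0" using m by (simp add: Z_def)
    from pseudo_mod[OF m0, of f] obtain c h where
      c: "c \<noteq> 0" "smult c f = m * h + pseudo_mod f m"
      and deg: "pseudo_mod f m = 0 \<or> degree (pseudo_mod f m) < degree m" by blast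
    have "ipoly (smult c f) q = 0"
      using that ipoly_mult[of "[:c:]" f q] by simp
    hence "ipoly (pseudo_mod f m) q = 0"
      using m by (simp add: c(2) ipoly_add ipoly_mult Z_def)
    \<comment> \<open>The remainder vanishes at \<open>q\<close>, so a nonzero one would contradict
      the minimal degree of \<open>m\<close>.\<close>
    hence "pseudo_mod f m = 0"
      using deg least[of "pseudo_mod f m"] by (force simp: Z_def)
    thus ?thesis using c by auto
  qed
  have "p dvd m"
  proof -
    from divides[OF p(2)] obtain c h where c: "c \<noteq> 0" "smult c p = m * h"
      by (metis dvdE)
    have "p dvd m * h" by (simp flip: c(2) add: dvd_smult)
    \<comment> \<open>Cancelling \<open>p\<close> would make the nonzero constant \<open>c\<close> a
      multiple of \<open>m\<close>, which vanishes at \<open>q\<close>.\<close>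
    moreover have False if ph: "p dvd h"
    proof -
      obtain k where "h = p * k" using ph by (rule dvdE)
      hence "p * [:c:] = p * (m * k)" using c(2) by (simp add: algebra_simps)
      hence "[:c:] = m * k" using p(1) by (metis mult_left_cancel irreducible_def)
      hence "ipoly [:c:] q = 0" using m by (simp add: ipoly_mult Z_def)
      thus False using c(1) by (simp add: ipoly_const)
    qed
    ultimately show ?thesis using prime_elem_dvd_multD[OF prime] by blast
  qed
  moreover obtain c where "c \<noteq> 0" "m dvd smult c P" using divides[OF assms(2)] by blast
  ultimately have "p dvd [:c:] * P" by (auto intro: dvd_trans)
  hence "p dvd P" using prime_elem_dvd_multD[OF prime] nonconst \<open>c \<noteq> 0\<close> by blast
  then obtain h where "P = p * h" by (rule dvdE)
  thus ?thesis using p(3) by (simp add: ipoly_mult)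
qed

section \<open>From an evaluated check to the bound\<close>

definition inv_golden :: real where
  "inv_golden = (sqrt 5 - 1) / 2"

text \<open>A smaller conjugate would lie in the disc, hence satisfy \<open>z^2 = z + 1\<close> and
  so \<open>1 \<le> cmod z ^ 2 + cmod z\<close>. This fails below the positive root of
  \<open>t^2 + t = 1\<close>.\<close>

lemma galois_conjugate_bound:
  assumes "galois_conjugate q z" and "check m k A B C D" and "form A B C D r n q = 0"
  shows "cmod z \<ge> inv_golden"
proof (rule ccontr)
  assume "\<not> ?thesis"
  hence small: "cmod z < (sqrt 5 - 1) / 2" by (simp add: inv_golden_def)
  \<comment> \<open>The value 9/4 is the one with \<open>(9/4 - 1) / 2 = 5/8\<close>.\<close>
  have "sqrt 5 < 9 / 4" by (rule real_less_lsqrt) (auto simp: power2_eq_square)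
  hence le: "cmod z \<le> 5 / 8" using small by simp
  define P where "P = Poly A + Poly B * monom 1 r + Poly C * monom 1 n + Poly D * monom 1 (r + n)"
  \<comment> \<open>Polymorphic, because it is used at the real \<open>q\<close> and at the complex
    \<open>z\<close>.\<close>
  have P: "ipoly P x = form A B C D r n x" for x :: "'a::comm_ring_1"
    by (simp add: P_def form_def ipoly_add ipoly_mult ipoly_monom ipoly_Poly)
  have "ipoly P z = 0"
    using root_of_galois_conjugate[OF assms(1)] assms(3) P by metis
  hence "z ^ 2 = z + 1" using check_root[OF assms(2) le] P by metis
  hence "1 = cmod (z ^ 2 - z)" by simp
  also have "\<dots> \<le> cmod z ^ 2 + cmod z"
    by (metis norm_power norm_triangle_ineq4)
  also have "\<dots> < ((sqrt 5 - 1) / 2) ^ 2 + (sqrt 5 - 1) / 2"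
    using small by (intro add_strict_mono power_strict_mono) auto
  also have "\<dots> = 1" by (simp add: power2_eq_square field_simps)
  finally show False by simp
qed

section \<open>Closed forms for the \<open>Psi\<close> families\<close>

text \<open>The sum in \<open>Psi\<close> grows with \<open>r\<close> and does not fit
  \<open>form\<close>. The factor \<open>x - 1\<close> telescopes it and adds only the root 1,
  outside the disc.\<close>

lemma Psi_times: "(x - 1) * Psi r x = x ^ (r + 1) * (x - 2) + 1"
proof -
  have "(x - 1) * (\<Sum>i\<le>r. x ^ i) = x ^ (r + 1) - 1"
    by (induction r) (auto simp: algebra_simps)
  thus ?thesis by (simp add: Psi_def algebra_simps)
qed

lemma geometric_times: "(x - 1) * (\<Sum>i<r. x ^ i) = x ^ r - (1::real)"
  by (induction r) (auto simp: algebra_simps)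

lemma PsiA_times: "(x - 1) * PsiA r n s x = (x ^ (r + 1) * (x - 2) + 1) * x ^ n + s * (x ^ (r + 1) - 1) * (x - 1)"
proof -
  have "(x - 1) * PsiA r n s x = ((x - 1) * Psi r x) * x ^ n + s * (x ^ (r + 1) - 1) * (x - 1)"
    by (simp add: PsiA_def algebra_simps)
  thus ?thesis by (simp only: Psi_times)
qed

lemma PsiB_times: "(x - 1) * PsiB r n s x = (x ^ (r + 1) * (x - 2) + 1) * x ^ n + s * (x ^ r - 1)"
proof -
  have "(x - 1) * PsiB r n s x = ((x - 1) * Psi r x) * x ^ n + s * ((x - 1) * (\<Sum>i<r. x ^ i))"
    by (simp add: PsiB_def algebra_simps)
  thus ?thesis by (simp only: Psi_times geometric_times)
qed

text \<open>For \<open>c < 0\<close> the expression does not grow with the exponent, so the sign for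
  a whole family follows from its smallest index.\<close>

lemma power_tail_neg:
  fixes x c e :: real
  assumes "1 \<le> x" and "m \<le> k" and "c < 0" and "x ^ m * c + e < 0"
  shows "x ^ k * c + e < 0"
proof -
  have "x ^ k * c \<le> x ^ m * c"
    using assms by (intro mult_right_mono_neg power_increasing) auto
  thus ?thesis using assms(4) by linarith
qed

section \<open>Conjugates of the limit points\<close>

text \<open>As in the families below, the lower bounds on the exponents are absorbed into the
  coefficient lists, so the exponents left in \<open>form\<close> range over all naturals.\<close>

lemma Phi_conjugate:
  assumes gc: "galois_conjugate q z" and root: "Phi (Suc r) q = 0"
  shows "cmod z \<ge> inv_golden"
proof (rule galois_conjugate_bound[OF gc])
  \<comment> \<open>The first 12 limits the depth of the case split, the second is the truncation
    order of \<open>1/A\<close>.\<close>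
  show "check 12 12 [-1, 1] [0, -2, 1] [] []" by code_simp
  show "form [-1, 1] [0, -2, 1] [] [] r 0 q = 0"
    using root by (simp add: form_def Phi_def algebra_simps power_add)
qed

lemma Psi_conjugate:
  assumes gc: "galois_conjugate q z" and root: "Psi (Suc r) q = 0"
  shows "cmod z \<ge> inv_golden"
proof (rule galois_conjugate_bound[OF gc])
  show "check 12 12 [1] [0, 0, -2, 1] [] []" by code_simp
  show "form [1] [0, 0, -2, 1] [] [] r 0 q = 0"
    using root Psi_times[of q "Suc r"] by (simp add: form_def algebra_simps power_add)
qed

lemma Chi_conjugate:
  assumes gc: "galois_conjugate q z" and root: "Chi q = 0"
  shows "cmod z \<ge> inv_golden"
proof (rule galois_conjugate_bound[OF gc])
  show "check 12 12 [1, 0, -2, -1, 1] [] [] []" by code_simp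
  show "form [1, 0, -2, -1, 1] [] [] [] 0 0 q = 0"
    using root by (simp add: form_def Chi_def eval_nat_numeral algebra_simps power_add)
qed

section \<open>Families with the plus sign\<close>

text \<open>From index 2 on, \<open>x^(r-1)\<close> has a factor \<open>x\<close> and the constant
  term stays 1; index 1 is reduced to \<open>PsiB\<close> in \<open>PhiA_conjugate\<close>.\<close>

lemma PhiA_conjugate_plus:
  assumes gc: "galois_conjugate q z" and root: "PhiA (Suc (Suc r)) (Suc (Suc n)) 1 q = 0"
  shows "cmod z \<ge> inv_golden"
proof (rule galois_conjugate_bound[OF gc])
  show "check 12 12 [1] [0, -1, 1] [0, 0, -1, 1] [0, 0, 0, 0, -2, 1]" by code_simp
  show "form [1] [0, -1, 1] [0, 0, -1, 1] [0, 0, 0, 0, -2, 1] r n q = 0"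
    using root by (simp add: form_def PhiA_def Phi_def algebra_simps power_add)
qed

lemma PhiA_conjugate_plus_1:
  assumes gc: "galois_conjugate q z" and root: "PhiA (Suc (Suc r)) (Suc 0) 1 q = 0"
  shows "cmod z \<ge> inv_golden"
proof (rule galois_conjugate_bound[OF gc])
  show "check 12 12 [1, -1, 1] [0, -1, 1, -2, 1] [] []" by code_simp
  show "form [1, -1, 1] [0, -1, 1, -2, 1] [] [] r 0 q = 0"
    using root by (simp add: form_def PhiA_def Phi_def algebra_simps power_add)
qed

lemma PhiB_conjugate_plus:
  assumes gc: "galois_conjugate q z" and root: "PhiB (Suc r) (Suc (Suc n)) 1 q = 0"
  shows "cmod z \<ge> inv_golden"
proof (rule galois_conjugate_bound[OF gc])
  show "check 12 12 [1, -1] [0, 1] [0, 0, -1, 1] [0, 0, 0, -2, 1]" by code_simp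
  show "form [1, -1] [0, 1] [0, 0, -1, 1] [0, 0, 0, -2, 1] r n q = 0"
    using root by (simp add: form_def PhiB_def Phi_def algebra_simps power_add)
qed

lemma PhiB_conjugate_plus_1:
  assumes gc: "galois_conjugate q z" and root: "PhiB (Suc r) (Suc 0) 1 q = 0"
  shows "cmod z \<ge> inv_golden"
proof (rule galois_conjugate_bound[OF gc])
  show "check 12 12 [1, -2, 1] [0, 1, -2, 1] [] []" by code_simp
  show "form [1, -2, 1] [0, 1, -2, 1] [] [] r 0 q = 0"
    using root by (simp add: form_def PhiB_def Phi_def algebra_simps power_add)
qed

lemma PhiC_conjugate_plus:
  assumes gc: "galois_conjugate q z" and root: "PhiC (Suc r) (Suc (Suc n)) 1 q = 0"
  shows "cmod z \<ge> inv_golden"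
proof (rule galois_conjugate_bound[OF gc])
  show "check 12 12 [-1, 1] [0, -1, 1] [0, 0, -1, 1] [0, 0, 0, -2, 1]" by code_simp
  show "form [-1, 1] [0, -1, 1] [0, 0, -1, 1] [0, 0, 0, -2, 1] r n q = 0"
    using root by (simp add: form_def PhiC_def Phi_def algebra_simps power_add)
qed

lemma PhiC_conjugate_plus_1:
  assumes gc: "galois_conjugate q z" and root: "PhiC (Suc r) (Suc 0) 1 q = 0"
  shows "cmod z \<ge> inv_golden"
proof (rule galois_conjugate_bound[OF gc])
  show "check 12 12 [-1, 0, 1] [0, -1, -1, 1] [] []" by code_simp
  show "form [-1, 0, 1] [0, -1, -1, 1] [] [] r 0 q = 0"
    using root by (simp add: form_def PhiC_def Phi_def algebra_simps power_add)
qed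

lemma PsiA_conjugate_plus:
  assumes gc: "galois_conjugate q z" and root: "PsiA (Suc r) (Suc (Suc (Suc n))) 1 q = 0"
  shows "cmod z \<ge> inv_golden"
proof (rule galois_conjugate_bound[OF gc])
  show "check 12 12 [1, -1] [0, 0, -1, 1] [0, 0, 0, 1] [0, 0, 0, 0, 0, -2, 1]" by code_simp
  show "form [1, -1] [0, 0, -1, 1] [0, 0, 0, 1] [0, 0, 0, 0, 0, -2, 1] r n q = 0"
    using root PsiA_times[of q "Suc r" "Suc (Suc (Suc n))" 1] by (simp add: form_def algebra_simps power_add)
qed

lemma PsiA_conjugate_plus_1:
  assumes gc: "galois_conjugate q z" and root: "PsiA (Suc r) (Suc 0) 1 q = 0"
  shows "cmod z \<ge> inv_golden"
proof (rule galois_conjugate_bound[OF gc])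
  \<comment> \<open>The contributions \<open>x\<close> and \<open>1 - x\<close> add up to 1.\<close>
  show "check 12 12 [1, 0] [0, 0, -1, -1, 1] [] []" by code_simp
  show "form [1, 0] [0, 0, -1, -1, 1] [] [] r 0 q = 0"
    using root PsiA_times[of q "Suc r" "Suc 0" 1] by (simp add: form_def algebra_simps power_add)
qed

lemma PsiA_conjugate_plus_2:
  assumes gc: "galois_conjugate q z" and root: "PsiA (Suc r) (Suc (Suc 0)) 1 q = 0"
  shows "cmod z \<ge> inv_golden"
proof (rule galois_conjugate_bound[OF gc])
  show "check 12 12 [1, -1, 1] [0, 0, -1, 1, -2, 1] [] []" by code_simp
  show "form [1, -1, 1] [0, 0, -1, 1, -2, 1] [] [] r 0 q = 0"
    using root PsiA_times[of q "Suc r" "Suc (Suc 0)" 1] by (simp add: form_def algebra_simps power_add)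
qed

lemma PsiB_conjugate_plus:
  assumes gc: "galois_conjugate q z" and root: "PsiB (Suc r) (Suc (Suc n)) 1 q = 0"
  shows "cmod z \<ge> inv_golden"
proof (rule galois_conjugate_bound[OF gc])
  show "check 12 12 [-1] [0, 1] [0, 0, 1] [0, 0, 0, 0, -2, 1]" by code_simp
  show "form [-1] [0, 1] [0, 0, 1] [0, 0, 0, 0, -2, 1] r n q = 0"
    using root PsiB_times[of q "Suc r" "Suc (Suc n)" 1] by (simp add: form_def algebra_simps power_add)
qed

lemma PsiB_conjugate_plus_1:
  assumes gc: "galois_conjugate q z" and root: "PsiB (Suc r) (Suc 0) 1 q = 0"
  shows "cmod z \<ge> inv_golden"
proof (rule galois_conjugate_bound[OF gc])
  show "check 12 12 [-1, 1] [0, 1, 0, -2, 1] [] []" by code_simp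
  show "form [-1, 1] [0, 1, 0, -2, 1] [] [] r 0 q = 0"
    using root PsiB_times[of q "Suc r" "Suc 0" 1] by (simp add: form_def algebra_simps power_add)
qed

lemma ChiA_conjugate_plus:
  assumes gc: "galois_conjugate q z" and root: "ChiA (Suc n) 1 q = 0"
  shows "cmod z \<ge> inv_golden"
proof (rule galois_conjugate_bound[OF gc])
  show "check 12 12 [-1, -1, 1, 1] [] [0, 1, 0, -2, -1, 1] []" by code_simp
  show "form [-1, -1, 1, 1] [] [0, 1, 0, -2, -1, 1] [] 0 n q = 0"
    using root by (simp add: form_def ChiA_def Chi_def eval_nat_numeral algebra_simps power_add)
qed

lemma ChiB_conjugate_plus:
  assumes gc: "galois_conjugate q z" and root: "ChiB (Suc n) 1 q = 0"
  shows "cmod z \<ge> inv_golden"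
proof (rule galois_conjugate_bound[OF gc])
  show "check 12 12 [1, 0, -1, 0, 1] [] [0, 1, 0, -2, -1, 1] []" by code_simp
  show "form [1, 0, -1, 0, 1] [] [0, 1, 0, -2, -1, 1] [] 0 n q = 0"
    using root by (simp add: form_def ChiB_def Chi_def eval_nat_numeral algebra_simps power_add)
qed

section \<open>Families with the minus sign\<close>

lemma PhiA_conjugate_minus:
  assumes gc: "galois_conjugate q z" and root: "PhiA (Suc (Suc r)) (Suc (Suc n)) (-1) q = 0"
  shows "cmod z \<ge> inv_golden"
proof (rule galois_conjugate_bound[OF gc])
  show "check 12 12 [-1] [0, 1, -1] [0, 0, -1, 1] [0, 0, 0, 0, -2, 1]" by code_simp
  show "form [-1] [0, 1, -1] [0, 0, -1, 1] [0, 0, 0, 0, -2, 1] r n q = 0"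
    using root by (simp add: form_def PhiA_def Phi_def algebra_simps power_add)
qed

lemma PhiB_conjugate_minus:
  assumes gc: "galois_conjugate q z" and root: "PhiB (Suc r) (Suc (Suc n)) (-1) q = 0"
  shows "cmod z \<ge> inv_golden"
proof (rule galois_conjugate_bound[OF gc])
  show "check 12 12 [-1, 1] [0, -1] [0, 0, -1, 1] [0, 0, 0, -2, 1]" by code_simp
  show "form [-1, 1] [0, -1] [0, 0, -1, 1] [0, 0, 0, -2, 1] r n q = 0"
    using root by (simp add: form_def PhiB_def Phi_def algebra_simps power_add)
qed

lemma PhiB_conjugate_minus_1:
  assumes gc: "galois_conjugate q z" and root: "PhiB (Suc r) (Suc 0) (-1) q = 0"
  shows "cmod z \<ge> inv_golden"
proof (rule galois_conjugate_bound[OF gc])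
  show "check 12 12 [-1, 0, 1] [0, -1, -2, 1] [] []" by code_simp
  show "form [-1, 0, 1] [0, -1, -2, 1] [] [] r 0 q = 0"
    using root by (simp add: form_def PhiB_def Phi_def algebra_simps power_add)
qed

lemma PhiC_conjugate_minus:
  assumes gc: "galois_conjugate q z" and root: "PhiC (Suc r) (Suc (Suc n)) (-1) q = 0"
  shows "cmod z \<ge> inv_golden"
proof (rule galois_conjugate_bound[OF gc])
  show "check 12 12 [1, -1] [0, 1, -1] [0, 0, -1, 1] [0, 0, 0, -2, 1]" by code_simp
  show "form [1, -1] [0, 1, -1] [0, 0, -1, 1] [0, 0, 0, -2, 1] r n q = 0"
    using root by (simp add: form_def PhiC_def Phi_def algebra_simps power_add)
qed

lemma PsiA_conjugate_minus:
  assumes gc: "galois_conjugate q z" and root: "PsiA (Suc r) (Suc (Suc (Suc n))) (-1) q = 0"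
  shows "cmod z \<ge> inv_golden"
proof (rule galois_conjugate_bound[OF gc])
  show "check 12 12 [-1, 1] [0, 0, 1, -1] [0, 0, 0, 1] [0, 0, 0, 0, 0, -2, 1]" by code_simp
  show "form [-1, 1] [0, 0, 1, -1] [0, 0, 0, 1] [0, 0, 0, 0, 0, -2, 1] r n q = 0"
    using root PsiA_times[of q "Suc r" "Suc (Suc (Suc n))" "(-1)"] by (simp add: form_def algebra_simps power_add)
qed

lemma PsiB_conjugate_minus:
  assumes gc: "galois_conjugate q z" and root: "PsiB (Suc r) (Suc (Suc n)) (-1) q = 0"
  shows "cmod z \<ge> inv_golden"
proof (rule galois_conjugate_bound[OF gc])
  show "check 12 12 [1] [0, -1] [0, 0, 1] [0, 0, 0, 0, -2, 1]" by code_simp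
  show "form [1] [0, -1] [0, 0, 1] [0, 0, 0, 0, -2, 1] r n q = 0"
    using root PsiB_times[of q "Suc r" "Suc (Suc n)" "(-1)"] by (simp add: form_def algebra_simps power_add)
qed

text \<open>This polynomial is \<open>Psi 2\<close>, whose root in (1,2) is the tribonacci constant,
  so a sign argument on (1,2) cannot dismiss it.\<close>

lemma PsiB_conjugate_minus_1_1:
  assumes gc: "galois_conjugate q z" and root: "PsiB (Suc 0) (Suc 0) (-1) q = 0"
  shows "cmod z \<ge> inv_golden"
proof (rule galois_conjugate_bound[OF gc])
  show "check 12 12 [-1, -1, -1, 1] [] [] []" by code_simp
  show "form [-1, -1, -1, 1] [] [] [] 0 0 q = 0"
    using root by (simp add: form_def PsiB_def Psi_def algebra_simps power_add)
qed

lemma ChiA_conjugate_minus: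
  assumes gc: "galois_conjugate q z" and root: "ChiA (Suc (Suc n)) (-1) q = 0"
  shows "cmod z \<ge> inv_golden"
proof (rule galois_conjugate_bound[OF gc])
  show "check 12 12 [1, 1, -1, -1] [] [0, 0, 1, 0, -2, -1, 1] []" by code_simp
  show "form [1, 1, -1, -1] [] [0, 0, 1, 0, -2, -1, 1] [] 0 n q = 0"
    using root by (simp add: form_def ChiA_def Chi_def eval_nat_numeral algebra_simps power_add)
qed

lemma ChiB_conjugate_minus:
  assumes gc: "galois_conjugate q z" and root: "ChiB (Suc n) (-1) q = 0"
  shows "cmod z \<ge> inv_golden"
proof (rule galois_conjugate_bound[OF gc])
  show "check 12 12 [-1, 0, 1, 0, -1] [] [0, 1, 0, -2, -1, 1] []" by code_simp
  show "form [-1, 0, 1, 0, -1] [] [0, 1, 0, -2, -1, 1] [] 0 n q = 0"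
    using root by (simp add: form_def ChiB_def Chi_def eval_nat_numeral algebra_simps power_add)
qed

section \<open>Members without a root in (1,2)\<close>

text \<open>The cubic multiplies the growing power of \<open>q\<close> in \<open>PhiA\<close> for
  \<open>n = 1\<close> and in \<open>(q - 1) * PsiA\<close> for \<open>n = 2\<close>, both with
  minus sign.\<close>

lemma cubic_neg:
  fixes x :: real
  assumes "1 < x" and "x < 2"
  shows "x ^ 3 - 2 * x ^ 2 - x + 1 < 0"
proof -
  have "x ^ 3 - 2 * x ^ 2 - x + 1 = x ^ 2 * (x - 2) - (x - 1)"
    by (simp add: algebra_simps eval_nat_numeral)
  moreover have "x ^ 2 * (x - 2) < 0" using assms by (intro mult_pos_neg) auto
  ultimately show ?thesis using assms by linarith
qed

lemma quadratic_neg: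
  fixes x :: real
  assumes "1 < x" and "x < 2"
  shows "x ^ 2 - 3 * x + 1 < 0"
proof -
  have "(x - 1) * (x - 2) < 0" using assms by (intro mult_pos_neg) auto
  thus ?thesis by (simp add: algebra_simps power2_eq_square)
qed

text \<open>Collecting powers gives a negative multiple of a power of \<open>q\<close> plus a part
  independent of \<open>r\<close>, so only the smallest index needs a direct estimate. The next four
  lemmas follow the same pattern, the \<open>Psi\<close> ones after multiplying by
  \<open>q - 1 > 0\<close>.\<close>

lemma PhiA_minus_1_neg:
  assumes "1 < q" and "q < 2"
  shows "PhiA (Suc r) (Suc 0) (-1) q < 0"
proof -
  have "q * ((q - 2) * (q + 1)) < 0" using assms by (intro mult_pos_neg mult_neg_pos) auto
  also have "q * ((q - 2) * (q + 1)) = q ^ 0 * (q ^ 3 - 2 * q ^ 2 - q + 1) + (q ^ 2 - q - 1)"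
    by (simp add: algebra_simps eval_nat_numeral)
  finally have base: "q ^ 0 * (q ^ 3 - 2 * q ^ 2 - q + 1) + (q ^ 2 - q - 1) < 0" .
  have "q ^ r * (q ^ 3 - 2 * q ^ 2 - q + 1) + (q ^ 2 - q - 1) < 0"
    using assms cubic_neg[OF assms] by (intro power_tail_neg[OF _ _ _ base]) auto
  moreover have "PhiA (Suc r) (Suc 0) (-1) q = q ^ r * (q ^ 3 - 2 * q ^ 2 - q + 1) + (q ^ 2 - q - 1)"
    by (simp add: PhiA_def Phi_def algebra_simps eval_nat_numeral)
  ultimately show ?thesis by simp
qed

lemma PhiC_minus_1_neg:
  assumes "1 < q" and "q < 2"
  shows "PhiC (Suc r) (Suc 0) (-1) q < 0"
proof -
  have "q ^ 3 - 2 * q ^ 2 - q + 1 < 0" using assms by (rule cubic_neg)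
  also have "q ^ 3 - 2 * q ^ 2 - q + 1 = q ^ 1 * (q ^ 2 - 3 * q + 1) + ((q - 1) ^ 2)"
    by (simp add: algebra_simps eval_nat_numeral)
  finally have base: "q ^ 1 * (q ^ 2 - 3 * q + 1) + ((q - 1) ^ 2) < 0" .
  have "q ^ Suc r * (q ^ 2 - 3 * q + 1) + ((q - 1) ^ 2) < 0"
    using assms quadratic_neg[OF assms] by (intro power_tail_neg[OF _ _ _ base]) auto
  moreover have "PhiC (Suc r) (Suc 0) (-1) q = q ^ Suc r * (q ^ 2 - 3 * q + 1) + ((q - 1) ^ 2)"
    by (simp add: PhiC_def Phi_def algebra_simps eval_nat_numeral)
  ultimately show ?thesis by simp
qed

lemma PsiA_minus_1_neg:
  assumes "1 < q" and "q < 2"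
  shows "PsiA (Suc r) (Suc 0) (-1) q < 0"
proof -
  have "(q - 1) * (q ^ 3 - 2 * q ^ 2 - q + 1) < 0"
    using assms cubic_neg[OF assms] by (intro mult_pos_neg) auto
  also have "(q - 1) * (q ^ 3 - 2 * q ^ 2 - q + 1) = q ^ 2 * (q ^ 2 - 3 * q + 1) + (2 * q - 1)"
    by (simp add: algebra_simps eval_nat_numeral)
  finally have base: "q ^ 2 * (q ^ 2 - 3 * q + 1) + (2 * q - 1) < 0" .
  have "q ^ Suc (Suc r) * (q ^ 2 - 3 * q + 1) + (2 * q - 1) < 0"
    using assms quadratic_neg[OF assms] by (intro power_tail_neg[OF _ _ _ base]) auto
  moreover have "(q - 1) * PsiA (Suc r) (Suc 0) (-1) q = q ^ Suc (Suc r) * (q ^ 2 - 3 * q + 1) + (2 * q - 1)"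
    unfolding PsiA_times by (simp add: algebra_simps eval_nat_numeral)
  ultimately have "(q - 1) * PsiA (Suc r) (Suc 0) (-1) q < 0" by simp
  thus ?thesis using assms by (simp add: mult_less_0_iff)
qed

text \<open>Index 1 is excluded because it gives \<open>Chi\<close>, which has a root in
  (1,2).\<close>

lemma PsiA_minus_2_neg:
  assumes "1 < q" and "q < 2"
  shows "PsiA (Suc (Suc r)) (Suc (Suc 0)) (-1) q < 0"
proof -
  have "q ^ 3 * ((q - 2) * (q + 1)) < 0" using assms by (intro mult_pos_neg mult_neg_pos) auto
  moreover have "1 < q ^ 2" using assms by (simp add: one_less_power)
  \<comment> \<open>The second factor is \<open>PsiA 2 2 (-1) q\<close>, the smallest case.\<close>
  ultimately have "(q - 1) * (q ^ 3 * ((q - 2) * (q + 1)) - (q ^ 2 - 1)) < 0"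
    using assms by (intro mult_pos_neg) linarith+
  also have "(q - 1) * (q ^ 3 * ((q - 2) * (q + 1)) - (q ^ 2 - 1)) = q ^ 3 * (q ^ 3 - 2 * q ^ 2 - q + 1) + (q ^ 2 + q - 1)"
    by (simp add: algebra_simps eval_nat_numeral)
  finally have base: "q ^ 3 * (q ^ 3 - 2 * q ^ 2 - q + 1) + (q ^ 2 + q - 1) < 0" .
  have "q ^ Suc (Suc (Suc r)) * (q ^ 3 - 2 * q ^ 2 - q + 1) + (q ^ 2 + q - 1) < 0"
    using assms cubic_neg[OF assms] by (intro power_tail_neg[OF _ _ _ base]) auto
  moreover have "(q - 1) * PsiA (Suc (Suc r)) (Suc (Suc 0)) (-1) q = q ^ Suc (Suc (Suc r)) * (q ^ 3 - 2 * q ^ 2 - q + 1) + (q ^ 2 + q - 1)"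
    unfolding PsiA_times by (simp add: algebra_simps eval_nat_numeral)
  ultimately have "(q - 1) * PsiA (Suc (Suc r)) (Suc (Suc 0)) (-1) q < 0" by simp
  thus ?thesis using assms by (simp add: mult_less_0_iff)
qed

lemma PsiB_minus_1_neg:
  assumes "1 < q" and "q < 2"
  shows "PsiB (Suc (Suc r)) (Suc 0) (-1) q < 0"
proof -
  have a: "q ^ 2 * (q - 2) < 0" and "q * (q - 2) < 0" using assms by (intro mult_pos_neg; simp)+
  moreover have "q ^ 2 * ((q - 2) * (q + 1)) < 0" using assms by (intro mult_pos_neg mult_neg_pos) auto
  ultimately have "(q - 1) * (q ^ 2 * ((q - 2) * (q + 1)) + q * (q - 2) - 1) < 0"
    using assms by (intro mult_pos_neg) linarith+
  also have "(q - 1) * (q ^ 2 * ((q - 2) * (q + 1)) + q * (q - 2) - 1) = q ^ 2 * (q ^ 2 * (q - 2) - 1) + (q + 1)"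
    by (simp add: algebra_simps eval_nat_numeral)
  finally have base: "q ^ 2 * (q ^ 2 * (q - 2) - 1) + (q + 1) < 0" .
  have "q ^ Suc (Suc r) * (q ^ 2 * (q - 2) - 1) + (q + 1) < 0"
    using assms a by (intro power_tail_neg[OF _ _ _ base]) auto
  moreover have "(q - 1) * PsiB (Suc (Suc r)) (Suc 0) (-1) q = q ^ Suc (Suc r) * (q ^ 2 * (q - 2) - 1) + (q + 1)"
    unfolding PsiB_times by (simp add: algebra_simps eval_nat_numeral)
  ultimately have "(q - 1) * PsiB (Suc (Suc r)) (Suc 0) (-1) q < 0" by simp
  thus ?thesis using assms by (simp add: mult_less_0_iff)
qed

text \<open>The value is \<open>- q^3 * (q + 1) * (2 - q) - q^3 - q^2 + 2 * q + 1\<close>. Bounding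
  the first product below by \<open>2 * (2 - q)\<close> leaves at most
  \<open>- 1 - (q - 1) * (q^2 + 2 * q - 2)\<close>.\<close>

lemma ChiA_minus_1_neg:
  assumes "1 < q" and "q < 2"
  shows "ChiA (Suc 0) (-1) q < 0"
proof -
  have "1 * (2 * (2 - q)) \<le> q ^ 3 * ((q + 1) * (2 - q))"
    using assms by (intro mult_mono) (auto simp: one_le_power)
  moreover have "1 < q ^ 2" using assms by (simp add: one_less_power)
  hence "0 < (q - 1) * (q ^ 2 + 2 * q - 2)"
    using assms by (intro mult_pos_pos) linarith+
  ultimately show ?thesis
    by (simp add: ChiA_def Chi_def algebra_simps eval_nat_numeral)
qed

section \<open>Assembly of the cases\<close>

lemma ge_1_cases:
  fixes n :: nat
  assumes "n \<ge> 1"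
  obtains "n = 1" | m where "n = Suc (Suc m)"
proof (cases n)
  case (Suc k)
  then show ?thesis using that by (cases k) auto
qed (use assms in simp)

lemma PhiA_conjugate:
  assumes gc: "galois_conjugate q z" and q: "1 < q" "q < 2"
    and r: "r \<ge> 1" and n: "n \<ge> 1" and s: "s \<in> {1, -1}" and root: "PhiA r n s q = 0"
  shows "cmod z \<ge> inv_golden"
proof (cases "r = 1")
  case True
  obtain n' where n': "n = Suc n'" using n by (cases n) auto
  \<comment> \<open>At \<open>r = 1\<close> the term \<open>x^r - x^(r-1) + 1\<close> collapses to
    \<open>x\<close>, and \<open>Phi 1 = Psi 1\<close>, so a factor \<open>q\<close> splits
    off.\<close>
  have "q * PsiB 1 n' s q = PhiA r n s q"
    by (simp add: True n' PsiB_def Psi_def PhiA_def Phi_def algebra_simps)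
  hence root': "PsiB (Suc 0) n' s q = 0" using root q by simp
  \<comment> \<open>For \<open>n' = 0\<close> the polynomial is \<open>x^2 - x\<close> or
    \<open>x^2 - x - 2\<close>, without roots in (1,2).\<close>
  have "n' \<noteq> 0"
  proof
    assume "n' = 0"
    hence "q * (q - 1) = 0 \<or> (q - 2) * (q + 1) = 0"
      using root' s by (auto simp: PsiB_def Psi_def algebra_simps)
    thus False using q by auto
  qed
  hence "n' \<ge> 1" by simp
  thus ?thesis
    by (cases rule: ge_1_cases)
      (use s root' in \<open>auto intro: PsiB_conjugate_plus[OF gc] PsiB_conjugate_minus[OF gc] PsiB_conjugate_plus_1[OF gc] PsiB_conjugate_minus_1_1[OF gc]\<close>)
next
  case False
  with r obtain r' where r': "r = Suc (Suc r')" by (cases rule: ge_1_cases) auto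
  from n show ?thesis
    by (cases rule: ge_1_cases)
      (use s root PhiA_minus_1_neg[OF q, of "Suc r'"] in \<open>auto simp: r' intro: PhiA_conjugate_plus[OF gc] PhiA_conjugate_minus[OF gc] PhiA_conjugate_plus_1[OF gc]\<close>)
qed

lemma PhiB_conjugate:
  assumes gc: "galois_conjugate q z"
    and r: "r \<ge> 1" and n: "n \<ge> 1" and s: "s \<in> {1, -1}" and root: "PhiB r n s q = 0"
  shows "cmod z \<ge> inv_golden"
proof -
  obtain r' where r': "r = Suc r'" using r by (cases r) auto
  from n show ?thesis
    by (cases rule: ge_1_cases)
      (use s root in \<open>auto simp: r' intro: PhiB_conjugate_plus[OF gc] PhiB_conjugate_minus[OF gc] PhiB_conjugate_plus_1[OF gc] PhiB_conjugate_minus_1[OF gc]\<close>)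
qed

lemma PhiC_conjugate:
  assumes gc: "galois_conjugate q z" and q: "1 < q" "q < 2"
    and r: "r \<ge> 1" and n: "n \<ge> 1" and s: "s \<in> {1, -1}" and root: "PhiC r n s q = 0"
  shows "cmod z \<ge> inv_golden"
proof -
  obtain r' where r': "r = Suc r'" using r by (cases r) auto
  from n show ?thesis
    by (cases rule: ge_1_cases)
      (use s root PhiC_minus_1_neg[OF q, of r'] in \<open>auto simp: r' intro: PhiC_conjugate_plus[OF gc] PhiC_conjugate_minus[OF gc] PhiC_conjugate_plus_1[OF gc]\<close>)
qed

lemma PsiA_conjugate:
  assumes gc: "galois_conjugate q z" and q: "1 < q" "q < 2"
    and r: "r \<ge> 1" and n: "n \<ge> 1" and s: "s \<in> {1, -1}" and root: "PsiA r n s q = 0"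
  shows "cmod z \<ge> inv_golden"
proof -
  obtain r' where r': "r = Suc r'" using r by (cases r) auto
  \<comment> \<open>This coincidence covers the member left out by
    \<open>PsiA_minus_2_neg\<close>.\<close>
  have Chi: "PsiA (Suc 0) (Suc (Suc 0)) (-1) q = Chi q"
    by (simp add: PsiA_def Psi_def Chi_def algebra_simps eval_nat_numeral)
  from n show ?thesis
  proof (cases rule: ge_1_cases)
    case 1
    then show ?thesis
      using s root PsiA_minus_1_neg[OF q, of r'] by (auto simp: r' intro: PsiA_conjugate_plus_1[OF gc])
  next
    case (2 m)
    show ?thesis
    proof (cases m)
      case 0
      have "PsiA (Suc (Suc k)) (Suc (Suc 0)) (-1) q \<noteq> 0" for k
        using PsiA_minus_2_neg[OF q, of k] by simp
      then show ?thesis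
        using s root Chi by (cases r') (auto simp: r' 2 0 intro: PsiA_conjugate_plus_2[OF gc] Chi_conjugate[OF gc])
    qed (use s root in \<open>auto simp: r' 2 intro: PsiA_conjugate_plus[OF gc] PsiA_conjugate_minus[OF gc]\<close>)
  qed
qed

lemma PsiB_conjugate:
  assumes gc: "galois_conjugate q z" and q: "1 < q" "q < 2"
    and r: "r \<ge> 1" and n: "n \<ge> 1" and s: "s \<in> {1, -1}" and root: "PsiB r n s q = 0"
  shows "cmod z \<ge> inv_golden"
proof -
  obtain r' where r': "r = Suc r'" using r by (cases r) auto
  have "PsiB (Suc (Suc k)) (Suc 0) (-1) q \<noteq> 0" for k
    using PsiB_minus_1_neg[OF q, of k] by simp
  with n s root show ?thesis
    by (cases rule: ge_1_cases; cases r')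
      (auto simp: r' intro: PsiB_conjugate_plus[OF gc] PsiB_conjugate_minus[OF gc] PsiB_conjugate_plus_1[OF gc] PsiB_conjugate_minus_1_1[OF gc])
qed

lemma ChiA_conjugate:
  assumes gc: "galois_conjugate q z" and q: "1 < q" "q < 2"
    and n: "n \<ge> 1" and s: "s \<in> {1, -1}" and root: "ChiA n s q = 0"
  shows "cmod z \<ge> inv_golden"
proof (cases rule: ge_1_cases[OF n])
qed (use s root ChiA_minus_1_neg[OF q] in \<open>auto intro: ChiA_conjugate_plus[OF gc] ChiA_conjugate_minus[OF gc]\<close>)

lemma ChiB_conjugate:
  assumes gc: "galois_conjugate q z"
    and n: "n \<ge> 1" and s: "s \<in> {1, -1}" and root: "ChiB n s q = 0"
  shows "cmod z \<ge> inv_golden"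
  using n s root by (cases n) (auto intro: ChiB_conjugate_plus[OF gc] ChiB_conjugate_minus[OF gc])

theorem theorem3p4:
  fixes q :: real and q' :: complex
  assumes "regular_pisot q" and "1 < q" and "q < 2"
    and "galois_conjugate q q'"
  shows "cmod q' \<ge> (sqrt 5 - 1) / 2"
proof -
  note conj = assms(4) and q = assms(2,3)
  consider (Phi) r where "r \<ge> 1" "Phi r q = 0"
    | (Psi) r where "r \<ge> 1" "Psi r q = 0"
    | (Chi) "Chi q = 0"
    | (family) r n s where "r \<ge> 1" "n \<ge> 1" "s \<in> {1, -1}"
        "PhiA r n s q = 0 \<or> PhiB r n s q = 0 \<or> PhiC r n s q = 0 \<or> PsiA r n s q = 0 \<or>
         PsiB r n s q = 0 \<or> ChiA n s q = 0 \<or> ChiB n s q = 0"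
    using assms(1) unfolding regular_pisot_def limit_pisot_def by blast
  then have "cmod q' \<ge> inv_golden"
  proof cases
    case (Phi r)
    then show ?thesis using Phi_conjugate[OF conj] by (cases r) auto
  next
    case (Psi r)
    then show ?thesis using Psi_conjugate[OF conj] by (cases r) auto
  next
    case Chi
    then show ?thesis by (rule Chi_conjugate[OF conj])
  next
    case (family r n s)
    note rns = family(1-3)
    from family(4) show ?thesis
      using PhiA_conjugate[OF conj q rns] PhiB_conjugate[OF conj rns] PhiC_conjugate[OF conj q rns]
        PsiA_conjugate[OF conj q rns] PsiB_conjugate[OF conj q rns]
        ChiA_conjugate[OF conj q rns(2,3)] ChiB_conjugate[OF conj rns(2,3)] by blast
  qed
  thus ?thesis by (simp add: inv_golden_def)
qed

end
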